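(* Let $M \colon \bigcup_{n=1}^\infty \mathbb{R}_+^n \to \mathbb{R}_+$ be a homogeneous and monotone mean. If there exists a sequence $(a_n)_{n=1}^\infty$ of positive reals such that $$\sum_{n=1}^\infty a_n=+\infty \quad\text{ and }\quad \lim_{n \to \infty} a_n^{-1} M(a_1,\dots,a_n) = +\infty,$$ then $M$ is not a weak-Hardy mean.
   Context: Here $\mathbb{R}_+=(0,+\infty)$. A mean on $\mathbb{R}_+$ is a function $M \colon \bigcup_{n=1}^\infty \mathbb{R}_+^n \to \mathbb{R}_+$ such that $\min(v)\le M(v)\le \max(v)$ for every vector $v$ in its domain. The mean $M$ is homogeneous if $M(tv_1,\dots,tv_n)=t\,M(v_1,\dots,v_n)$ for all $n\in\mathbb{N}$, $t>0$ and $(v_1,\dots,v_n)\in\mathbb{R}_+^n$. It is monotone if for every $n\in\mathbb{N}$ the restriction $M|_{\mathbb{R}_+^n}$ is nondecreasing in each of its variables. Let $\ell_1(\mathbb{R}_+)$ denote the set of sequences $a=(a_n)_{n=1}^\infty$ of elements of $\mathbb{R}_+$ with $\sum_{n=1}^\infty a_n<+\infty$. The mean $M$ is a weak-Hardy mean if $$\sum_{n=1}^\infty M(a_1,\dots,a_n) < +\infty \quad \text{for all } a \in \ell_1(\mathbb{R}_+).$$ *)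

theory Defs
  imports Complex_Main
begin

(* The union over n >= 1 of R_+^n, with vectors as nonempty lists. A mean is a function on
   all lists of which only the values on this set matter. *)
definition pos_vectors :: "real list set" where
  "pos_vectors = {v. v \<noteq> [] \<and> (\<forall>x\<in>set v. 0 < x)}"

(* Positivity of M v follows from the lower bound. *)
definition is_mean :: "(real list \<Rightarrow> real) \<Rightarrow> bool" where
  "is_mean M \<longleftrightarrow> (\<forall>v\<in>pos_vectors. Min (set v) \<le> M v \<and> M v \<le> Max (set v))"

definition homogeneous_mean :: "(real list \<Rightarrow> real) \<Rightarrow> bool" where
  "homogeneous_mean M \<longleftrightarrow>
     is_mean M \<and> (\<forall>v\<in>pos_vectors. \<forall>t>0. M (map (\<lambda>x. t * x) v) = t * M v)"

definition monotone_mean :: "(real list \<Rightarrow> real) \<Rightarrow> bool" where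
  "monotone_mean M \<longleftrightarrow>
     is_mean M \<and>
     (\<forall>v\<in>pos_vectors. \<forall>i<length v. \<forall>x\<ge>v ! i. M v \<le> M (v[i := x]))"

(* Sequences are indexed from 0, so M (map a [0..<Suc n]) is the mean of the first n + 1
   terms. All series here have positive terms, so summability means that the sum is finite. *)
definition weak_hardy_mean :: "(real list \<Rightarrow> real) \<Rightarrow> bool" where
  "weak_hardy_mean M \<longleftrightarrow>
     is_mean M \<and>
     (\<forall>a :: nat \<Rightarrow> real. (\<forall>n. 0 < a n) \<longrightarrow> summable a \<longrightarrow>
        summable (\<lambda>n. M (map a [0..<Suc n])))"

end

theory Submission
  imports Defs
begin

text \<open>
  The idea is to damp the given sequence \<open>a\<close> by a positive nonincreasing weight sequence \<open>c\<close>.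
  For \<open>k \<le> n\<close> we have \<open>c k * a k \<ge> c n * a k\<close>, so monotonicity and homogeneity give
  \<open>M (c 0 * a 0, \<dots>, c n * a n) \<ge> c n * M (a 0, \<dots>, a n)\<close>
  (lemma \<open>homogeneous_monotone_mean_damped\<close>). Writing \<open>P n = M (a 0, \<dots>, a n)\<close>, it therefore
  suffices to choose \<open>c\<close> such that \<open>\<Sum> c n * a n\<close> converges while \<open>\<Sum> c n * P n\<close> diverges;
  the sequence \<open>c n * a n\<close> then violates the weak-Hardy property.

  This is now a question about two positive sequences with \<open>\<Sum> a n = \<infinity>\<close> and
  \<open>P n / a n \<longlonglongrightarrow> \<infinity>\<close>, answered by lemma \<open>decreasing_weights_separating_series\<close>. By a
  Stolz-Cesaro argument the ratio of the partial sums of \<open>P\<close> and \<open>a\<close> also tends to infinity.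
  So for each \<open>j\<close> some initial segment \<open>{..<N j}\<close> carries at least \<open>2 ^ j\<close> times as much of
  \<open>P\<close> as of \<open>a\<close>. Superposing the indicators of these segments, scaled so that the \<open>j\<close>-th one
  contributes \<open>2 ^ -j\<close> to \<open>\<Sum> c n * a n\<close>, makes it contribute at least \<open>1\<close> to
  \<open>\<Sum> c n * P n\<close>; and a superposition of indicators of initial segments is nonincreasing.
\<close>

text \<open>
  The vector \<open>u\<close> is turned into \<open>v\<close> by replacing its entries one at a time from the left.
\<close>

lemma monotone_mean_mono:
  assumes M: "monotone_mean M"
    and u: "u \<in> pos_vectors" and le: "list_all2 (\<le>) u v"
  shows "M u \<le> M v"
proof -
  have len: "length u = length v"
    using le by (rule list_all2_lengthD)
  have nth: "u ! i \<le> v ! i" if "i < length v" for i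
    using list_all2_nthD2[OF le that] .
  have upos: "0 < u ! i" if "i < length v" for i
    using u that len by (auto simp: pos_vectors_def)
  have vpos: "0 < v ! i" if "i < length v" for i
    using nth[OF that] upos[OF that] by linarith
  have "k \<le> length v \<Longrightarrow> M u \<le> M (take k v @ drop k u)" for k
  proof (induction k)
    case 0
    then show ?case by simp
  next
    case (Suc k)
    let ?w = "take k v @ drop k u"
    have k: "k < length v" using Suc.prems by simp
    have "?w \<noteq> []" using k len by auto
    moreover have "0 < x" if "x \<in> set ?w" for x
      using that upos vpos len by (auto simp: in_set_conv_nth)
    ultimately have w: "?w \<in> pos_vectors"
      by (auto simp: pos_vectors_def)
    have step: "take (Suc k) v @ drop (Suc k) u = ?w[k := v ! k]"
      using k len by (simp add: take_Suc_conv_app_nth list_update_append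
          Cons_nth_drop_Suc[symmetric] del: Cons_nth_drop_Suc)
    have "?w ! k \<le> v ! k" using k len nth by (simp add: nth_append)
    moreover have "k < length ?w" using k len by simp
    ultimately have "M ?w \<le> M (?w[k := v ! k])"
      using M w unfolding monotone_mean_def by blast
    with Suc.IH k step show ?case by simp
  qed
  from this[of "length v"] len show ?thesis by simp
qed

lemma homogeneous_monotone_mean_damped:
  fixes a c :: "nat \<Rightarrow> real"
  assumes hom: "homogeneous_mean M" and mono: "monotone_mean M"
    and a: "\<And>n. 0 < a n" and c: "\<And>n. 0 < c n" and dec: "decseq c"
  shows "c n * M (map a [0..<Suc n]) \<le> M (map (\<lambda>k. c k * a k) [0..<Suc n])"
proof -
  have "map a [0..<Suc n] \<in> pos_vectors"
    using a by (auto simp: pos_vectors_def)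
  then have "c n * M (map a [0..<Suc n]) = M (map (\<lambda>x. c n * x) (map a [0..<Suc n]))"
    using hom c[of n] by (simp add: homogeneous_mean_def del: upt_Suc map_map)
  also have "\<dots> \<le> M (map (\<lambda>k. c k * a k) [0..<Suc n])"
  proof (rule monotone_mean_mono[OF mono])
    show "map (\<lambda>x. c n * x) (map a [0..<Suc n]) \<in> pos_vectors"
      using a c by (auto simp: pos_vectors_def)
    show "list_all2 (\<le>) (map (\<lambda>x. c n * x) (map a [0..<Suc n]))
            (map (\<lambda>k. c k * a k) [0..<Suc n])"
      using a dec by (auto simp: list_all2_conv_all_nth less_Suc_eq_le less_imp_le
          decseq_def simp del: upt_Suc intro!: mult_right_mono)
  qed
  finally show ?thesis .
qed

text \<open>
  A one-sided Stolz-Cesaro statement: from some index \<open>n0\<close> on the terms satisfy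
  \<open>P n \<ge> 2 * C * a n\<close>, and half of this bound is given up to compensate for the finitely many
  terms before \<open>n0\<close>, whose share of the divergent sum of \<open>a\<close> becomes negligible.
\<close>

lemma partial_sums_ratio_unbounded:
  fixes a P :: "nat \<Rightarrow> real"
  assumes a: "\<And>n. 0 < a n" and P: "\<And>n. 0 \<le> P n"
    and div: "filterlim (\<lambda>N. \<Sum>n<N. a n) at_top sequentially"
    and ratio: "filterlim (\<lambda>n. inverse (a n) * P n) at_top sequentially"
    and C: "0 \<le> C"
  shows "eventually (\<lambda>N. C * (\<Sum>n<N. a n) \<le> (\<Sum>n<N. P n)) sequentially"
proof -
  have "eventually (\<lambda>n. 2 * C \<le> inverse (a n) * P n) sequentially"
    using ratio by (simp add: filterlim_at_top)
  then obtain n0 where n0: "\<And>n. n0 \<le> n \<Longrightarrow> 2 * C \<le> inverse (a n) * P n"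
    by (auto simp: eventually_sequentially)
  have big: "2 * C * a n \<le> P n" if "n0 \<le> n" for n
    using n0[OF that] a[of n] by (simp add: field_simps)
  have "eventually (\<lambda>N. 2 * (\<Sum>n<n0. a n) \<le> (\<Sum>n<N. a n)) sequentially"
    using div by (simp add: filterlim_at_top)
  with eventually_ge_at_top[of n0] show ?thesis
  proof eventually_elim
    case (elim N)
    have split: "(\<Sum>n<N. f n) = (\<Sum>n<n0. f n) + (\<Sum>n=n0..<N. f n)" for f :: "nat \<Rightarrow> real"
      using sum.atLeastLessThan_concat[of 0 n0 N f] elim by (simp add: lessThan_atLeast0)
    have "C * (\<Sum>n<N. a n) \<le> 2 * C * (\<Sum>n=n0..<N. a n)"
      using mult_left_mono[OF elim(2) C] split[of a] by (simp add: algebra_simps)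
    also have "\<dots> \<le> (\<Sum>n=n0..<N. P n)"
      by (auto simp: sum_distrib_left intro!: sum_mono big)
    also have "\<dots> \<le> (\<Sum>n<N. P n)"
      using split[of P] P by (simp add: sum_nonneg)
    finally show ?case .
  qed
qed

text \<open>
  The weights are \<open>c n = (\<Sum>j. w j * indicator {..<N j} n)\<close>. Both series are linear in \<open>c\<close>, so
  only their values on each initial segment \<open>{..<N j}\<close> matter, and there the growth of the ratio
  of partial sums applies.
\<close>

lemma decreasing_weights_separating_series:
  fixes a P :: "nat \<Rightarrow> real"
  assumes a: "\<And>n. 0 < a n" and P: "\<And>n. 0 \<le> P n"
    and div: "filterlim (\<lambda>N. \<Sum>n<N. a n) at_top sequentially"
    and ratio: "filterlim (\<lambda>n. inverse (a n) * P n) at_top sequentially"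
  obtains c :: "nat \<Rightarrow> real"
  where "\<And>n. 0 < c n" "decseq c" "summable (\<lambda>n. c n * a n)" "\<not> summable (\<lambda>n. c n * P n)"
proof -
  define S where "S N = (\<Sum>n<N. a n)" for N
  define T where "T N = (\<Sum>n<N. P n)" for N
  have "\<exists>N>j. 2 ^ j * S N \<le> T N" for j
  proof -
    have "eventually (\<lambda>N. 2 ^ j * S N \<le> T N) sequentially"
      unfolding S_def T_def by (rule partial_sums_ratio_unbounded[OF a P div ratio]) simp
    with eventually_gt_at_top[of j] have "eventually (\<lambda>N. j < N \<and> 2 ^ j * S N \<le> T N) sequentially"
      by eventually_elim simp
    then show ?thesis
      by (rule eventually_happens'[OF sequentially_bot])
  qed
  then obtain N where N: "\<And>j. j < N j" "\<And>j. 2 ^ j * S (N j) \<le> T (N j)"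
    by metis
  have a0_le: "a 0 \<le> S (N j)" for j
    unfolding S_def using N(1)[of j] a by (intro member_le_sum) (auto simp: less_imp_le)
  have S_pos: "0 < S (N j)" for j
    using a0_le[of j] a[of 0] by linarith
  (* Division by S (N j) makes the j-th segment contribute exactly (1/2) ^ j to the sum of c * a. *)
  define w where "w j = (1/2) ^ j / S (N j)" for j
  define g where "g n j = (if n < N j then w j else 0)" for n j
  define c where "c n = (\<Sum>j. g n j)" for n
  have w_pos: "0 < w j" for j
    using S_pos by (simp add: w_def)
  have geom: "summable (\<lambda>j. (1/2) ^ j :: real)"
    by (rule summable_geometric) simp
  have "summable (\<lambda>j. (1/2) ^ j / a 0)"
    using geom by (rule summable_divide)
  moreover have "norm (w j) \<le> (1/2) ^ j / a 0" for j
  proof -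
    have "w j \<le> (1/2) ^ j / a 0"
      unfolding w_def using a0_le S_pos a by (intro divide_left_mono mult_pos_pos) auto
    then show ?thesis using w_pos[of j] by simp
  qed
  ultimately have w_summable: "summable w"
    by (rule summable_comparison_test'[where N = 0])
  have g_nonneg: "0 \<le> g n j" for n j
    using w_pos[of j] by (simp add: g_def)
  have g_summable: "summable (g n)" for n
    by (rule summable_comparison_test'[OF w_summable, where N = 0])
      (use w_pos in \<open>auto simp: g_def less_imp_le\<close>)
  (* The n-th segment reaches beyond n, so every index is covered. *)
  have c_pos: "0 < c n" for n
    unfolding c_def using N(1)[of n] w_pos[of n] g_nonneg
    by (intro suminf_pos2[OF g_summable, where i = n]) (auto simp: g_def)
  have c_dec: "decseq c"
    unfolding decseq_def c_def
    using w_pos by (auto intro!: suminf_le g_summable simp: g_def less_imp_le)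
  have segment: "(\<Sum>n<m. g n j * f n) = w j * (\<Sum>n<min m (N j). f n)" for m j f
  proof -
    have "(\<Sum>n<m. g n j * f n) = (\<Sum>n<min m (N j). w j * f n)"
      by (rule sum.mono_neutral_cong_right) (auto simp: g_def)
    then show ?thesis by (simp add: sum_distrib_left)
  qed
  have upper: "(\<Sum>n<m. c n * a n) \<le> 2" for m
  proof -
    have sm: "summable (\<lambda>j. g n j * a n)" for n
      using g_summable by (rule summable_mult2)
    have "(\<Sum>n<m. c n * a n) = (\<Sum>n<m. \<Sum>j. g n j * a n)"
      by (simp add: c_def suminf_mult2 g_summable)
    also have "\<dots> = (\<Sum>j. \<Sum>n<m. g n j * a n)"
      by (rule suminf_sum[symmetric]) (rule sm)
    also have "\<dots> \<le> (\<Sum>j. (1/2) ^ j)"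
    proof (rule suminf_le[OF _ summable_sum[OF sm] geom])
      fix j
      have "(\<Sum>n<min m (N j). a n) \<le> S (N j)"
        unfolding S_def using a by (intro sum_mono2) (auto simp: less_imp_le)
      then have "w j * (\<Sum>n<min m (N j). a n) \<le> w j * S (N j)"
        using w_pos[of j] by (simp add: mult_left_mono)
      also have "\<dots> = (1/2) ^ j"
        using S_pos[of j] by (simp add: w_def)
      finally show "(\<Sum>n<m. g n j * a n) \<le> (1/2) ^ j"
        by (simp add: segment)
    qed
    also have "\<dots> = 2"
      by (simp add: suminf_geometric)
    finally show ?thesis .
  qed
  have conv: "summable (\<lambda>n. c n * a n)"
    using c_pos a upper by (intro summableI_nonneg_bounded[where x = 2]) (auto simp: less_imp_le)
  have lower: "\<exists>m. real J \<le> (\<Sum>n<m. c n * P n)" for J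
  proof -
    (* Any m beyond the first J segments would do. *)
    define m where "m = (\<Sum>j<J. N j)"
    have m: "N j \<le> m" if "j < J" for j
      unfolding m_def using that by (intro member_le_sum) auto
    have "1 \<le> w j * T (N j)" for j
    proof -
      have "1 = w j * (2 ^ j * S (N j))"
        using S_pos[of j] by (simp add: w_def power_divide)
      also have "\<dots> \<le> w j * T (N j)"
        using N(2)[of j] w_pos[of j] by simp
      finally show ?thesis .
    qed
    then have "real J \<le> (\<Sum>j<J. w j * T (N j))"
      using sum_mono[of "{..<J}" "\<lambda>_. 1" "\<lambda>j. w j * T (N j)"] by simp
    also have "\<dots> = (\<Sum>j<J. \<Sum>n<m. g n j * P n)"
      using m by (intro sum.cong) (auto simp: segment T_def min_absorb2)
    also have "\<dots> = (\<Sum>n<m. (\<Sum>j<J. g n j) * P n)"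
      by (subst sum.swap) (simp add: sum_distrib_right)
    also have "\<dots> \<le> (\<Sum>n<m. c n * P n)"
      unfolding c_def using P g_nonneg
      by (intro sum_mono mult_right_mono sum_le_suminf g_summable) auto
    finally show ?thesis by blast
  qed
  have "\<not> summable (\<lambda>n. c n * P n)"
  proof
    assume sm: "summable (\<lambda>n. c n * P n)"
    obtain J where J: "(\<Sum>n. c n * P n) < real J"
      using reals_Archimedean2 by blast
    obtain m where "real J \<le> (\<Sum>n<m. c n * P n)"
      using lower by blast
    also have "\<dots> \<le> (\<Sum>n. c n * P n)"
      using c_pos P by (intro sum_le_suminf sm) (auto simp: less_imp_le)
    finally show False using J by simp
  qed
  with c_pos c_dec conv show ?thesis by (rule that)
qed

theorem theorem1:
  fixes M :: "real list \<Rightarrow> real"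
  assumes "is_mean M" and "homogeneous_mean M" and "monotone_mean M"
    and "\<exists>a :: nat \<Rightarrow> real. (\<forall>n. 0 < a n) \<and>
           filterlim (\<lambda>N. \<Sum>n<N. a n) at_top sequentially \<and>
           filterlim (\<lambda>n. inverse (a n) * M (map a [0..<Suc n])) at_top sequentially"
  shows "\<not> weak_hardy_mean M"
proof
  assume hardy: "weak_hardy_mean M"
  obtain a :: "nat \<Rightarrow> real" where a: "\<And>n. 0 < a n"
    and div: "filterlim (\<lambda>N. \<Sum>n<N. a n) at_top sequentially"
    and ratio: "filterlim (\<lambda>n. inverse (a n) * M (map a [0..<Suc n])) at_top sequentially"
    using assms(4) by blast
  have P: "0 \<le> M (map a [0..<Suc n])" for n
  proof -
    have "map a [0..<Suc n] \<in> pos_vectors"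
      using a by (auto simp: pos_vectors_def)
    then have "Min (set (map a [0..<Suc n])) \<le> M (map a [0..<Suc n])"
      using assms(1) unfolding is_mean_def by blast
    moreover have "0 < Min (set (map a [0..<Suc n]))"
      using a by (subst Min_gr_iff) auto
    ultimately show ?thesis by linarith
  qed
  obtain c :: "nat \<Rightarrow> real" where c: "\<And>n. 0 < c n" and dec: "decseq c"
    and conv: "summable (\<lambda>n. c n * a n)"
    and nconv: "\<not> summable (\<lambda>n. c n * M (map a [0..<Suc n]))"
    using decreasing_weights_separating_series[OF a P div ratio] by blast
  have "summable (\<lambda>n. M (map (\<lambda>k. c k * a k) [0..<Suc n]))"
    using hardy a c conv by (simp add: weak_hardy_mean_def del: upt_Suc)
  then have "summable (\<lambda>n. c n * M (map a [0..<Suc n]))"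
  proof (rule summable_comparison_test'[where N = 0])
    fix n :: nat
    have "0 \<le> c n * M (map a [0..<Suc n])"
      using c[of n] P[of n] by (intro mult_nonneg_nonneg) simp_all
    then show "norm (c n * M (map a [0..<Suc n])) \<le> M (map (\<lambda>k. c k * a k) [0..<Suc n])"
      using homogeneous_monotone_mean_damped[OF assms(2,3) a c dec, of n]
      by (simp del: upt_Suc)
  qed
  with nconv show False ..
qed

end
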